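(* Let $\mathcal{B}$ be a braided monoidal category with braiding $\Psi$, $B$ a bialgebra in $\mathcal{B}$ and $\sigma\colon B\otimes B\to I$ a right 2-cocycle of $B$. Then $\Delta$ gives a left action of the monoidal category $B\text{-}\mathbf{Mod}(\mathcal{B})$ on the category $B_\sigma\text{-}\mathbf{Mod}(\mathcal{B})$, where for a $B$-module $V$ and a $B_\sigma$-module $W$ the object $V\triangleright W$ is $V\otimes W$ with the $B_\sigma$-action given by the coproduct of $B$, $$\triangleright_{V\otimes W}=(\triangleright_V\otimes \triangleright_W)(\mathrm{id}_B\otimes \Psi_{B, V}\otimes \mathrm{id}_W)(\Delta\otimes \mathrm{id}_V\otimes \mathrm{id}_W).$$
   Context: $\mathcal{B}$ is treated as strict monoidal with unit $I$. A bialgebra in $\mathcal{B}$ is an object $B$ that is an algebra $(m,1)$ and a coalgebra $(\Delta,\varepsilon)$ with $\Delta m=(m\otimes m)(\mathrm{id}\otimes\Psi\otimes\mathrm{id})(\Delta\otimes\Delta)$ (and the usual unit/counit compatibilities). A right 2-cocycle of $B$ is a morphism $\sigma\colon B\otimes B\to I$ such that $m_\sigma:=(m\otimes\sigma)(\mathrm{id}_B\otimes\Psi_{B,B}\otimes\mathrm{id}_B)(\Delta\otimes\Delta)\colon B\otimes B\to B$ gives $B$ an algebra structure, with unit $1$ (so $\sigma(\mathrm{id}\otimes 1)=\sigma(1\otimes\mathrm{id})=\varepsilon$); this algebra is denoted $B_\sigma$ and called the right cocycle twist of $B$ by $\sigma$. Here, inside $m_\sigma$, the four tensor factors of $(\Delta\otimes\Delta)$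 are rearranged by the braiding on the middle two, then the first two are multiplied and $\sigma$ is applied to the last two. $A\text{-}\mathbf{Mod}(\mathcal{B})$ is the category of left $A$-modules in $\mathcal{B}$; for $A=B$ it is monoidal via $\Delta$. A left action of a monoidal category on a category means a module category structure. *)

theory Defs
  imports Main
begin

section \<open>Categories and functors\<close>

record ('o, 'a) cat =
  Ob :: "'o set"
  Ar :: "'a set"
  Dom :: "'a \<Rightarrow> 'o"
  Cod :: "'a \<Rightarrow> 'o"
  Ide :: "'o \<Rightarrow> 'a"  ("\<iota>\<index>")
  Comp :: "'a \<Rightarrow> 'a \<Rightarrow> 'a"  (infixr "\<cdot>\<index>" 55)

definition hom :: "('o, 'a, 'z) cat_scheme \<Rightarrow> 'o \<Rightarrow> 'o \<Rightarrow> 'a set" where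
  "hom C X Y = {f \<in> Ar C. Dom C f = X \<and> Cod C f = Y}"

locale category =
  fixes C :: "('o, 'a, 'z) cat_scheme" (structure)
  assumes dom_closed: "f \<in> Ar C \<Longrightarrow> Dom C f \<in> Ob C"
    and cod_closed: "f \<in> Ar C \<Longrightarrow> Cod C f \<in> Ob C"
    and ide_hom: "X \<in> Ob C \<Longrightarrow> \<iota> X \<in> hom C X X"
    and comp_hom: "\<lbrakk>f \<in> hom C X Y; g \<in> hom C Y Z\<rbrakk> \<Longrightarrow> g \<cdot> f \<in> hom C X Z"
    and comp_ide_right: "f \<in> hom C X Y \<Longrightarrow> f \<cdot> \<iota> X = f"
    and comp_ide_left: "f \<in> hom C X Y \<Longrightarrow> \<iota> Y \<cdot> f = f"
    and comp_assoc: "\<lbrakk>f \<in> hom C W X; g \<in> hom C X Y; h \<in> hom C Y Z\<rbrakk>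
      \<Longrightarrow> (h \<cdot> g) \<cdot> f = h \<cdot> (g \<cdot> f)"

definition iso_hom :: "('o, 'a, 'z) cat_scheme \<Rightarrow> 'o \<Rightarrow> 'o \<Rightarrow> 'a set" where
  "iso_hom C X Y = {f \<in> hom C X Y. \<exists>g \<in> hom C Y X.
     Comp C g f = Ide C X \<and> Comp C f g = Ide C Y}"

definition prod_cat ::
  "('o, 'a, 'y) cat_scheme \<Rightarrow> ('p, 'b, 'z) cat_scheme \<Rightarrow> ('o \<times> 'p, 'a \<times> 'b) cat" where
  "prod_cat C D = \<lparr>
     Ob = Ob C \<times> Ob D,
     Ar = Ar C \<times> Ar D,
     Dom = map_prod (Dom C) (Dom D),
     Cod = map_prod (Cod C) (Cod D),
     Ide = map_prod (Ide C) (Ide D),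
     Comp = (\<lambda>(g, g') (f, f'). (Comp C g f, Comp D g' f'))\<rparr>"

locale cat_functor = C: category C + D: category D
  for C :: "('o, 'a, 'y) cat_scheme" and D :: "('p, 'b, 'z) cat_scheme" +
  fixes FO :: "'o \<Rightarrow> 'p" and FA :: "'a \<Rightarrow> 'b"
  assumes ob_closed: "X \<in> Ob C \<Longrightarrow> FO X \<in> Ob D"
    and hom_closed: "f \<in> hom C X Y \<Longrightarrow> FA f \<in> hom D (FO X) (FO Y)"
    and preserves_ide: "X \<in> Ob C \<Longrightarrow> FA (Ide C X) = Ide D (FO X)"
    and preserves_comp: "\<lbrakk>f \<in> hom C X Y; g \<in> hom C Y Z\<rbrakk>
      \<Longrightarrow> FA (Comp C g f) = Comp D (FA g) (FA f)"


section \<open>Monoidal categories and module categories\<close>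

text \<open>The tensor product is written \<open>\<boxtimes>\<close> on objects and \<open>\<otimes>\<close> on arrows.\<close>

record ('o, 'a) mon_cat = "('o, 'a) cat" +
  TensOb :: "'o \<Rightarrow> 'o \<Rightarrow> 'o"  (infixr "\<boxtimes>\<index>" 70)
  TensAr :: "'a \<Rightarrow> 'a \<Rightarrow> 'a"  (infixr "\<otimes>\<index>" 70)
  Unit :: 'o  ("\<one>\<index>")
  Assoc :: "'o \<Rightarrow> 'o \<Rightarrow> 'o \<Rightarrow> 'a"
  LUnit :: "'o \<Rightarrow> 'a"
  RUnit :: "'o \<Rightarrow> 'a"

locale monoidal_category = category C
  for C :: "('o, 'a, 'z) mon_cat_scheme" (structure) +
  assumes tensor_functor: "cat_functor (prod_cat C C) C
      (\<lambda>(X, Y). X \<boxtimes> Y) (\<lambda>(f, g). f \<otimes> g)"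
    and unit_ob: "\<one> \<in> Ob C"
    and assoc_iso: "\<lbrakk>X \<in> Ob C; Y \<in> Ob C; Z \<in> Ob C\<rbrakk>
      \<Longrightarrow> Assoc C X Y Z \<in> iso_hom C ((X \<boxtimes> Y) \<boxtimes> Z) (X \<boxtimes> (Y \<boxtimes> Z))"
    and assoc_natural: "\<lbrakk>f \<in> hom C X X'; g \<in> hom C Y Y'; h \<in> hom C Z Z'\<rbrakk>
      \<Longrightarrow> Assoc C X' Y' Z' \<cdot> ((f \<otimes> g) \<otimes> h) = (f \<otimes> (g \<otimes> h)) \<cdot> Assoc C X Y Z"
    and lunit_iso: "X \<in> Ob C \<Longrightarrow> LUnit C X \<in> iso_hom C (\<one> \<boxtimes> X) X"
    and lunit_natural: "f \<in> hom C X Y \<Longrightarrow> LUnit C Y \<cdot> (\<iota> \<one> \<otimes> f) = f \<cdot> LUnit C X"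
    and runit_iso: "X \<in> Ob C \<Longrightarrow> RUnit C X \<in> iso_hom C (X \<boxtimes> \<one>) X"
    and runit_natural: "f \<in> hom C X Y \<Longrightarrow> RUnit C Y \<cdot> (f \<otimes> \<iota> \<one>) = f \<cdot> RUnit C X"
    and pentagon: "\<lbrakk>W \<in> Ob C; X \<in> Ob C; Y \<in> Ob C; Z \<in> Ob C\<rbrakk>
      \<Longrightarrow> Assoc C W X (Y \<boxtimes> Z) \<cdot> Assoc C (W \<boxtimes> X) Y Z
        = (\<iota> W \<otimes> Assoc C X Y Z) \<cdot> Assoc C W (X \<boxtimes> Y) Z \<cdot> (Assoc C W X Y \<otimes> \<iota> Z)"
    and triangle: "\<lbrakk>X \<in> Ob C; Y \<in> Ob C\<rbrakk>
      \<Longrightarrow> (\<iota> X \<otimes> LUnit C Y) \<cdot> Assoc C X \<one> Y = RUnit C X \<otimes> \<iota> Y"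

locale strict_monoidal_category = monoidal_category C
  for C :: "('o, 'a, 'z) mon_cat_scheme" (structure) +
  assumes tensor_ob_assoc: "\<lbrakk>X \<in> Ob C; Y \<in> Ob C; Z \<in> Ob C\<rbrakk>
      \<Longrightarrow> (X \<boxtimes> Y) \<boxtimes> Z = X \<boxtimes> (Y \<boxtimes> Z)"
    and tensor_ob_unit_left: "X \<in> Ob C \<Longrightarrow> \<one> \<boxtimes> X = X"
    and tensor_ob_unit_right: "X \<in> Ob C \<Longrightarrow> X \<boxtimes> \<one> = X"
    and assoc_strict: "\<lbrakk>X \<in> Ob C; Y \<in> Ob C; Z \<in> Ob C\<rbrakk>
      \<Longrightarrow> Assoc C X Y Z = \<iota> (X \<boxtimes> (Y \<boxtimes> Z))"
    and lunit_strict: "X \<in> Ob C \<Longrightarrow> LUnit C X = \<iota> X"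
    and runit_strict: "X \<in> Ob C \<Longrightarrow> RUnit C X = \<iota> X"

text \<open>
  A left action of the monoidal category \<open>C\<close> on the category \<open>M\<close>: a functor
  \<open>C \<times> M \<rightarrow> M\<close>, given by \<open>AO\<close> on objects and \<open>AA\<close> on arrows, together with an
  associativity constraint \<open>\<mu>\<close> and a unit constraint \<open>\<eta>\<close>.
\<close>

locale left_module_category = C: monoidal_category C + M: category M
  for C :: "('o, 'a, 'y) mon_cat_scheme" and M :: "('p, 'b, 'z) cat_scheme" +
  fixes AO :: "'o \<Rightarrow> 'p \<Rightarrow> 'p"
    and AA :: "'a \<Rightarrow> 'b \<Rightarrow> 'b"
    and \<mu> :: "'o \<Rightarrow> 'o \<Rightarrow> 'p \<Rightarrow> 'b"
    and \<eta> :: "'p \<Rightarrow> 'b"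
  assumes action_functor: "cat_functor (prod_cat C M) M (\<lambda>(X, P). AO X P) (\<lambda>(f, p). AA f p)"
    and act_assoc_iso: "\<lbrakk>X \<in> Ob C; Y \<in> Ob C; P \<in> Ob M\<rbrakk>
      \<Longrightarrow> \<mu> X Y P \<in> iso_hom M (AO (TensOb C X Y) P) (AO X (AO Y P))"
    and act_assoc_natural: "\<lbrakk>f \<in> hom C X X'; g \<in> hom C Y Y'; p \<in> hom M P P'\<rbrakk>
      \<Longrightarrow> Comp M (\<mu> X' Y' P') (AA (TensAr C f g) p) = Comp M (AA f (AA g p)) (\<mu> X Y P)"
    and act_unit_iso: "P \<in> Ob M \<Longrightarrow> \<eta> P \<in> iso_hom M (AO (Unit C) P) P"
    and act_unit_natural: "p \<in> hom M P P'
      \<Longrightarrow> Comp M (\<eta> P') (AA (Ide C (Unit C)) p) = Comp M p (\<eta> P)"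
    and act_pentagon: "\<lbrakk>X \<in> Ob C; Y \<in> Ob C; Z \<in> Ob C; P \<in> Ob M\<rbrakk>
      \<Longrightarrow> Comp M (\<mu> X Y (AO Z P)) (\<mu> (TensOb C X Y) Z P)
        = Comp M (AA (Ide C X) (\<mu> Y Z P))
            (Comp M (\<mu> X (TensOb C Y Z) P) (AA (Assoc C X Y Z) (Ide M P)))"
    and act_triangle: "\<lbrakk>X \<in> Ob C; P \<in> Ob M\<rbrakk>
      \<Longrightarrow> Comp M (AA (Ide C X) (\<eta> P)) (\<mu> X (Unit C) P) = AA (RUnit C X) (Ide M P)"

record ('o, 'a) braided_cat = "('o, 'a) mon_cat" +
  Braid :: "'o \<Rightarrow> 'o \<Rightarrow> 'a"  ("\<Psi>\<index>")

text \<open>The hexagon axioms are stated without associators, which are identities here.\<close>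

locale strict_braided_monoidal_category = strict_monoidal_category C
  for C :: "('o, 'a, 'z) braided_cat_scheme" (structure) +
  assumes braid_iso: "\<lbrakk>X \<in> Ob C; Y \<in> Ob C\<rbrakk> \<Longrightarrow> \<Psi> X Y \<in> iso_hom C (X \<boxtimes> Y) (Y \<boxtimes> X)"
    and braid_natural: "\<lbrakk>f \<in> hom C X X'; g \<in> hom C Y Y'\<rbrakk>
      \<Longrightarrow> \<Psi> X' Y' \<cdot> (f \<otimes> g) = (g \<otimes> f) \<cdot> \<Psi> X Y"
    and hexagon_left: "\<lbrakk>X \<in> Ob C; Y \<in> Ob C; Z \<in> Ob C\<rbrakk>
      \<Longrightarrow> \<Psi> (X \<boxtimes> Y) Z = (\<Psi> X Z \<otimes> \<iota> Y) \<cdot> (\<iota> X \<otimes> \<Psi> Y Z)"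
    and hexagon_right: "\<lbrakk>X \<in> Ob C; Y \<in> Ob C; Z \<in> Ob C\<rbrakk>
      \<Longrightarrow> \<Psi> X (Y \<boxtimes> Z) = (\<iota> Y \<otimes> \<Psi> X Z) \<cdot> (\<Psi> X Y \<otimes> \<iota> Z)"


section \<open>Algebras, coalgebras, bialgebras and cocycles\<close>

locale algebra_object = strict_monoidal_category C
  for C :: "('o, 'a, 'z) mon_cat_scheme" (structure) +
  fixes A :: 'o and m :: 'a and u :: 'a
  assumes alg_ob: "A \<in> Ob C"
    and mult_hom: "m \<in> hom C (A \<boxtimes> A) A"
    and unit_hom: "u \<in> hom C \<one> A"
    and mult_assoc: "m \<cdot> (m \<otimes> \<iota> A) = m \<cdot> (\<iota> A \<otimes> m)"
    and mult_unit_left: "m \<cdot> (u \<otimes> \<iota> A) = \<iota> A"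
    and mult_unit_right: "m \<cdot> (\<iota> A \<otimes> u) = \<iota> A"

locale coalgebra_object = strict_monoidal_category C
  for C :: "('o, 'a, 'z) mon_cat_scheme" (structure) +
  fixes A :: 'o and \<Delta> :: 'a and \<epsilon> :: 'a
  assumes coalg_ob: "A \<in> Ob C"
    and comult_hom: "\<Delta> \<in> hom C A (A \<boxtimes> A)"
    and counit_hom: "\<epsilon> \<in> hom C A \<one>"
    and comult_coassoc: "(\<Delta> \<otimes> \<iota> A) \<cdot> \<Delta> = (\<iota> A \<otimes> \<Delta>) \<cdot> \<Delta>"
    and comult_counit_left: "(\<epsilon> \<otimes> \<iota> A) \<cdot> \<Delta> = \<iota> A"
    and comult_counit_right: "(\<iota> A \<otimes> \<epsilon>) \<cdot> \<Delta> = \<iota> A"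

locale bialgebra = strict_braided_monoidal_category C + algebra_object C B m u +
  coalgebra_object C B \<Delta> \<epsilon>
  for C :: "('o, 'a, 'z) braided_cat_scheme" (structure)
    and B :: 'o and m u \<Delta> \<epsilon> :: 'a +
  assumes comult_mult: "\<Delta> \<cdot> m = (m \<otimes> m) \<cdot> (\<iota> B \<otimes> \<Psi> B B \<otimes> \<iota> B) \<cdot> (\<Delta> \<otimes> \<Delta>)"
    and comult_unit: "\<Delta> \<cdot> u = u \<otimes> u"
    and counit_mult: "\<epsilon> \<cdot> m = \<epsilon> \<otimes> \<epsilon>"
    and counit_unit: "\<epsilon> \<cdot> u = \<iota> \<one>"

definition twisted_mult :: "('o, 'a, 'z) braided_cat_scheme \<Rightarrow> 'o \<Rightarrow> 'a \<Rightarrow> 'a \<Rightarrow> 'a \<Rightarrow> 'a" where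
  "twisted_mult C B m \<Delta> \<sigma> =
     (m \<otimes>\<^bsub>C\<^esub> \<sigma>) \<cdot>\<^bsub>C\<^esub> (\<iota>\<^bsub>C\<^esub> B \<otimes>\<^bsub>C\<^esub> \<Psi>\<^bsub>C\<^esub> B B \<otimes>\<^bsub>C\<^esub> \<iota>\<^bsub>C\<^esub> B) \<cdot>\<^bsub>C\<^esub> (\<Delta> \<otimes>\<^bsub>C\<^esub> \<Delta>)"

locale right_two_cocycle = bialgebra C B m u \<Delta> \<epsilon>
  for C :: "('o, 'a, 'z) braided_cat_scheme" (structure)
    and B :: 'o and m u \<Delta> \<epsilon> :: 'a +
  fixes \<sigma> :: 'a
  assumes cocycle_hom: "\<sigma> \<in> hom C (B \<boxtimes> B) \<one>"
    and twist_algebra: "algebra_object C B (twisted_mult C B m \<Delta> \<sigma>) u"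


section \<open>Categories of modules\<close>

locale left_module = algebra_object C A m u
  for C :: "('o, 'a, 'z) mon_cat_scheme" (structure)
    and A :: 'o and m u :: 'a +
  fixes V :: 'o and a :: 'a
  assumes module_ob: "V \<in> Ob C"
    and act_hom: "a \<in> hom C (A \<boxtimes> V) V"
    and act_mult: "a \<cdot> (m \<otimes> \<iota> V) = a \<cdot> (\<iota> A \<otimes> a)"
    and act_unit: "a \<cdot> (u \<otimes> \<iota> V) = \<iota> V"

text \<open>
  An object of the category of modules is a pair of an underlying object and its action. An
  arrow \<open>(X, Y, f)\<close> records its source and target, since the underlying arrow \<open>f\<close> does not
  determine the actions.
\<close>

type_synonym ('o, 'a) mod_ob = "'o \<times> 'a"
type_synonym ('o, 'a) mod_ar = "('o, 'a) mod_ob \<times> ('o, 'a) mod_ob \<times> 'a"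

definition Mod :: "('o, 'a, 'z) mon_cat_scheme \<Rightarrow> 'o \<Rightarrow> 'a \<Rightarrow> 'a
    \<Rightarrow> (('o, 'a) mod_ob, ('o, 'a) mod_ar) cat" where
  "Mod C A m u = \<lparr>
     Ob = {(V, a). left_module C A m u V a},
     Ar = {((V, a), (W, b), f). left_module C A m u V a \<and> left_module C A m u W b \<and>
             f \<in> hom C V W \<and> f \<cdot>\<^bsub>C\<^esub> a = b \<cdot>\<^bsub>C\<^esub> (\<iota>\<^bsub>C\<^esub> A \<otimes>\<^bsub>C\<^esub> f)},
     Dom = (\<lambda>(X, Y, f). X),
     Cod = (\<lambda>(X, Y, f). Y),
     Ide = (\<lambda>X. (X, X, \<iota>\<^bsub>C\<^esub> (fst X))),
     Comp = (\<lambda>(Y, Z, g) (X, Y', f). (X, Z, g \<cdot>\<^bsub>C\<^esub> f))\<rparr>"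

text \<open>
  The following two operations serve both as the tensor product of \<open>B\<close>-modules and as the
  action of \<open>B\<close>-modules on \<open>B\<^sub>\<sigma>\<close>-modules.
\<close>

definition tensor_mod :: "('o, 'a, 'z) braided_cat_scheme \<Rightarrow> 'o \<Rightarrow> 'a
    \<Rightarrow> ('o, 'a) mod_ob \<Rightarrow> ('o, 'a) mod_ob \<Rightarrow> ('o, 'a) mod_ob" where
  "tensor_mod C B \<Delta> = (\<lambda>(V, a) (W, b).
     (V \<boxtimes>\<^bsub>C\<^esub> W,
      (a \<otimes>\<^bsub>C\<^esub> b) \<cdot>\<^bsub>C\<^esub> (\<iota>\<^bsub>C\<^esub> B \<otimes>\<^bsub>C\<^esub> \<Psi>\<^bsub>C\<^esub> B V \<otimes>\<^bsub>C\<^esub> \<iota>\<^bsub>C\<^esub> W) \<cdot>\<^bsub>C\<^esub> (\<Delta> \<otimes>\<^bsub>C\<^esub> \<iota>\<^bsub>C\<^esub> V \<otimes>\<^bsub>C\<^esub> \<iota>\<^bsub>C\<^esub> W)))"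

definition tensor_mod_ar :: "('o, 'a, 'z) braided_cat_scheme \<Rightarrow> 'o \<Rightarrow> 'a
    \<Rightarrow> ('o, 'a) mod_ar \<Rightarrow> ('o, 'a) mod_ar \<Rightarrow> ('o, 'a) mod_ar" where
  "tensor_mod_ar C B \<Delta> = (\<lambda>(X, X', f) (Y, Y', g).
     (tensor_mod C B \<Delta> X Y, tensor_mod C B \<Delta> X' Y', f \<otimes>\<^bsub>C\<^esub> g))"

text \<open>
  Since \<open>\<one> \<boxtimes> V = V\<close>, a counit \<open>\<epsilon> : B \<rightarrow> \<one>\<close> is an action of \<open>B\<close> on \<open>\<one>\<close>. The constraints are
  those of \<open>C\<close>, regarded as arrows between modules.
\<close>

definition triv_mod :: "('o, 'a, 'z) braided_cat_scheme \<Rightarrow> 'a \<Rightarrow> ('o, 'a) mod_ob" where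
  "triv_mod C \<epsilon> = (\<one>\<^bsub>C\<^esub>, \<epsilon>)"

definition mod_assoc :: "('o, 'a, 'z) braided_cat_scheme \<Rightarrow> 'o \<Rightarrow> 'a
    \<Rightarrow> ('o, 'a) mod_ob \<Rightarrow> ('o, 'a) mod_ob \<Rightarrow> ('o, 'a) mod_ob \<Rightarrow> ('o, 'a) mod_ar" where
  "mod_assoc C B \<Delta> X Y Z =
     (tensor_mod C B \<Delta> (tensor_mod C B \<Delta> X Y) Z,
      tensor_mod C B \<Delta> X (tensor_mod C B \<Delta> Y Z),
      Assoc C (fst X) (fst Y) (fst Z))"

definition mod_lunit :: "('o, 'a, 'z) braided_cat_scheme \<Rightarrow> 'o \<Rightarrow> 'a \<Rightarrow> 'a
    \<Rightarrow> ('o, 'a) mod_ob \<Rightarrow> ('o, 'a) mod_ar" where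
  "mod_lunit C B \<Delta> \<epsilon> X = (tensor_mod C B \<Delta> (triv_mod C \<epsilon>) X, X, LUnit C (fst X))"

definition mod_runit :: "('o, 'a, 'z) braided_cat_scheme \<Rightarrow> 'o \<Rightarrow> 'a \<Rightarrow> 'a
    \<Rightarrow> ('o, 'a) mod_ob \<Rightarrow> ('o, 'a) mod_ar" where
  "mod_runit C B \<Delta> \<epsilon> X = (tensor_mod C B \<Delta> X (triv_mod C \<epsilon>), X, RUnit C (fst X))"

definition Mod_monoidal :: "('o, 'a, 'z) braided_cat_scheme \<Rightarrow> 'o \<Rightarrow> 'a \<Rightarrow> 'a \<Rightarrow> 'a \<Rightarrow> 'a
    \<Rightarrow> (('o, 'a) mod_ob, ('o, 'a) mod_ar) mon_cat" where
  "Mod_monoidal C B m u \<Delta> \<epsilon> = cat.extend (Mod C B m u)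
     (mon_cat.fields (tensor_mod C B \<Delta>) (tensor_mod_ar C B \<Delta>) (triv_mod C \<epsilon>)
        (mod_assoc C B \<Delta>) (mod_lunit C B \<Delta> \<epsilon>) (mod_runit C B \<Delta> \<epsilon>))"

end

theory Submission
  imports Defs
begin

text \<open>
  A left \<open>B\<close>-comodule algebra \<open>A\<close> has modules on which \<open>B\<close>-modules act: for a \<open>B\<close>-module \<open>V\<close> and an
  \<open>A\<close>-module \<open>W\<close>, the algebra \<open>A\<close> acts on \<open>V \<boxtimes> W\<close> through its coaction \<open>A \<rightarrow> B \<boxtimes> A\<close>. The theorem holds
  because the right cocycle twist of \<open>B\<close> is such an algebra with coaction \<open>\<Delta>\<close>, that is,
  \<open>\<Delta> \<cdot> m\<^sub>\<sigma> = (m \<otimes> m\<^sub>\<sigma>) \<cdot> \<Delta>\<^sub>2\<close>, where \<open>\<Delta>\<^sub>2\<close> is the coproduct of the tensor square coalgebra \<open>B \<boxtimes> B\<close>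
  (\<open>comult_twisted_mult\<close>). Indeed \<open>m\<^sub>\<sigma> = (m \<otimes> \<sigma>) \<cdot> \<Delta>\<^sub>2\<close>, the product \<open>m\<close> intertwines \<open>\<Delta>\<^sub>2\<close> with \<open>\<Delta>\<close>, and
  \<open>\<Delta>\<^sub>2\<close> is coassociative. That \<open>m\<^sub>\<sigma>\<close> is associative is the cocycle condition.

  The case \<open>n = m\<close> of the same argument says that \<open>B\<close>-modules are closed under tensor products. Both
  cases are therefore treated together, for a second algebra structure \<open>(B, n, u)\<close> compatible with
  \<open>\<Delta>\<close> in the above sense (locale \<open>twisted_bialgebra\<close>).

  All diagrams are expressed by the arrow \<open>split_past V : D \<boxtimes> V \<rightarrow> D \<boxtimes> V \<boxtimes> D\<close>, which duplicates a
  coalgebra \<open>D\<close> and braids one copy past \<open>V\<close>. It is natural in \<open>V\<close>, coassociative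
  (\<open>split_past_tensor\<close>), and compatible with the coproduct of \<open>D \<boxtimes> D\<close> (\<open>split_past_sq\<close>). The first
  two properties give functoriality of \<open>V \<boxtimes> W\<close> and strict associativity of the action
  (\<open>tensor_mod_assoc\<close>); naturality and the third property show that \<open>V \<boxtimes> W\<close> is a module
  (\<open>tensor_left_module\<close>).

  Since the ambient category is strict, the tensor product of modules is associative and unital on
  the nose, actions included. All constraints are identities, and the coherence axioms of monoidal
  and module categories hold trivially (\<open>strict_monoidal_categoryI\<close>,
  \<open>strict_left_module_categoryI\<close>).
\<close>

section \<open>Calculating in strict monoidal categories\<close>

context category
begin

lemma in_hom_iff: "f \<in> hom C X Y \<longleftrightarrow> f \<in> Ar C \<and> Dom C f = X \<and> Cod C f = Y"
  by (auto simp: hom_def)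

lemma Dom_Ob [simp]: "f \<in> Ar C \<Longrightarrow> Dom C f \<in> Ob C"
  and Cod_Ob [simp]: "f \<in> Ar C \<Longrightarrow> Cod C f \<in> Ob C"
  by (fact dom_closed cod_closed)+

lemma ide_simps [simp]:
  assumes "X \<in> Ob C"
  shows "\<iota> X \<in> Ar C" "Dom C (\<iota> X) = X" "Cod C (\<iota> X) = X"
  using ide_hom[OF assms] by (auto simp: in_hom_iff)

lemma comp_simps [simp]:
  assumes "f \<in> Ar C" "g \<in> Ar C" "Dom C g = Cod C f"
  shows "g \<cdot> f \<in> Ar C" "Dom C (g \<cdot> f) = Dom C f" "Cod C (g \<cdot> f) = Cod C g"
  using comp_hom[of f "Dom C f" "Cod C f" g "Cod C g"] assms by (auto simp: in_hom_iff)

lemma comp_ide [simp]: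
  assumes "f \<in> Ar C"
  shows "Dom C f = X \<Longrightarrow> f \<cdot> \<iota> X = f" "Cod C f = Y \<Longrightarrow> \<iota> Y \<cdot> f = f"
  using assms comp_ide_right comp_ide_left by (auto simp: in_hom_iff)

lemma comp_assoc_arr [simp]:
  assumes "f \<in> Ar C" "g \<in> Ar C" "h \<in> Ar C" "Dom C g = Cod C f" "Dom C h = Cod C g"
  shows "(h \<cdot> g) \<cdot> f = h \<cdot> g \<cdot> f"
  using comp_assoc[of f "Dom C f" "Cod C f" g "Cod C g" h "Cod C h"] assms
  by (auto simp: in_hom_iff)

text \<open>
  Composites are normalised to be bracketed to the right, so the left-hand side of an equation
  \<open>g \<cdot> f = g' \<cdot> f'\<close> no longer occurs in a longer composite. This form of the equation does, and it
  is how a relation between string diagrams is applied inside a larger diagram.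
\<close>

lemma comp_extend:
  assumes "g \<cdot> f = g' \<cdot> f'"
    and "f \<in> Ar C" "g \<in> Ar C" "Dom C g = Cod C f" "f' \<in> Ar C" "g' \<in> Ar C" "Dom C g' = Cod C f'"
    and "k \<in> Ar C" "Cod C k = Dom C f"
  shows "g \<cdot> f \<cdot> k = g' \<cdot> f' \<cdot> k"
  using assms comp_simps(2)[of f g] comp_simps(2)[of f' g'] by (metis comp_assoc_arr)

lemma ide_iso_hom: "X \<in> Ob C \<Longrightarrow> \<iota> X \<in> iso_hom C X X"
  by (auto simp: iso_hom_def in_hom_iff)

end

context strict_monoidal_category
begin

lemma tensor_Ob [simp]: "X \<in> Ob C \<Longrightarrow> Y \<in> Ob C \<Longrightarrow> X \<boxtimes> Y \<in> Ob C"
  using cat_functor.ob_closed[OF tensor_functor, of "(X, Y)"] by (simp add: prod_cat_def)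

lemma unit_Ob [simp]: "\<one> \<in> Ob C"
  by (fact unit_ob)

lemma tensor_arr_simps [simp]:
  assumes "f \<in> Ar C" "g \<in> Ar C"
  shows "f \<otimes> g \<in> Ar C" "Dom C (f \<otimes> g) = Dom C f \<boxtimes> Dom C g"
    "Cod C (f \<otimes> g) = Cod C f \<boxtimes> Cod C g"
  using cat_functor.hom_closed[OF tensor_functor,
      of "(f, g)" "(Dom C f, Dom C g)" "(Cod C f, Cod C g)"] assms
  by (auto simp: prod_cat_def hom_def)

lemma tensor_ide [simp]: "X \<in> Ob C \<Longrightarrow> Y \<in> Ob C \<Longrightarrow> \<iota> X \<otimes> \<iota> Y = \<iota> (X \<boxtimes> Y)"
  using cat_functor.preserves_ide[OF tensor_functor, of "(X, Y)"] by (simp add: prod_cat_def)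

lemma interchange:
  assumes "f \<in> Ar C" "g \<in> Ar C" "f' \<in> Ar C" "g' \<in> Ar C" "Dom C g = Cod C f" "Dom C g' = Cod C f'"
  shows "(g \<otimes> g') \<cdot> (f \<otimes> f') = (g \<cdot> f) \<otimes> (g' \<cdot> f')"
  using cat_functor.preserves_comp[OF tensor_functor,
      of "(f, f')" "(Dom C f, Dom C f')" "(Cod C f, Cod C f')" "(g, g')" "(Cod C g, Cod C g')"] assms
  by (auto simp: prod_cat_def hom_def)

lemma interchange_comp:
  assumes "f \<in> Ar C" "g \<in> Ar C" "f' \<in> Ar C" "g' \<in> Ar C" "Dom C g = Cod C f" "Dom C g' = Cod C f'"
    and "k \<in> Ar C" "Cod C k = Dom C f \<boxtimes> Dom C f'"
  shows "(g \<otimes> g') \<cdot> (f \<otimes> f') \<cdot> k = ((g \<cdot> f) \<otimes> (g' \<cdot> f')) \<cdot> k"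
  using interchange[OF assms(1-6)] comp_assoc_arr[of k "f \<otimes> f'" "g \<otimes> g'"] assms by simp

lemma tensor_Ob_strict [simp]:
  "X \<in> Ob C \<Longrightarrow> Y \<in> Ob C \<Longrightarrow> Z \<in> Ob C \<Longrightarrow> (X \<boxtimes> Y) \<boxtimes> Z = X \<boxtimes> Y \<boxtimes> Z"
  "X \<in> Ob C \<Longrightarrow> \<one> \<boxtimes> X = X" "X \<in> Ob C \<Longrightarrow> X \<boxtimes> \<one> = X"
  by (simp_all add: tensor_ob_assoc tensor_ob_unit_left tensor_ob_unit_right)

lemma tensor_arr_strict [simp]:
  assumes "f \<in> Ar C"
  shows "g \<in> Ar C \<Longrightarrow> h \<in> Ar C \<Longrightarrow> (f \<otimes> g) \<otimes> h = f \<otimes> g \<otimes> h"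
    and "\<iota> \<one> \<otimes> f = f" and "f \<otimes> \<iota> \<one> = f"
proof -
  show "(f \<otimes> g) \<otimes> h = f \<otimes> g \<otimes> h" if "g \<in> Ar C" "h \<in> Ar C"
    using assoc_natural[of f "Dom C f" "Cod C f" g "Dom C g" "Cod C g" h "Dom C h" "Cod C h"]
      assms that
    by (simp add: in_hom_iff assoc_strict)
  show "\<iota> \<one> \<otimes> f = f"
    using lunit_natural[of f "Dom C f" "Cod C f"] assms by (simp add: in_hom_iff lunit_strict)
  show "f \<otimes> \<iota> \<one> = f"
    using runit_natural[of f "Dom C f" "Cod C f"] assms by (simp add: in_hom_iff runit_strict)
qed

text \<open>
  Together with \<open>tensor_ide\<close> this fixes a normal form for whiskered arrows: identities to the left
  of an arrow are split into single strands, those to its right are merged into one.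
\<close>

lemma ide_tensor_split [simp]:
  "X \<in> Ob C \<Longrightarrow> Y \<in> Ob C \<Longrightarrow> f \<in> Ar C \<Longrightarrow> \<iota> (X \<boxtimes> Y) \<otimes> f = \<iota> X \<otimes> \<iota> Y \<otimes> f"
  by (simp flip: tensor_ide)

lemma exchange:
  assumes "f \<in> Ar C" "g \<in> Ar C"
  shows "(f \<otimes> \<iota> (Cod C g)) \<cdot> (\<iota> (Dom C f) \<otimes> g) = (\<iota> (Cod C f) \<otimes> g) \<cdot> (f \<otimes> \<iota> (Dom C g))"
  using assms by (simp add: interchange)

lemma whisker_left:
  assumes "X \<in> Ob C" "f \<in> Ar C" "g \<in> Ar C" "Dom C g = Cod C f"
  shows "\<iota> X \<otimes> (g \<cdot> f) = (\<iota> X \<otimes> g) \<cdot> (\<iota> X \<otimes> f)"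
  using assms by (simp add: interchange)

lemma whisker_right:
  assumes "X \<in> Ob C" "f \<in> Ar C" "g \<in> Ar C" "Dom C g = Cod C f"
  shows "(g \<cdot> f) \<otimes> \<iota> X = (g \<otimes> \<iota> X) \<cdot> (f \<otimes> \<iota> X)"
  using assms by (simp add: interchange)

end

section \<open>Coalgebras and the braiding\<close>

context strict_braided_monoidal_category
begin

lemma braid_simps [simp]:
  assumes "X \<in> Ob C" "Y \<in> Ob C"
  shows "\<Psi> X Y \<in> Ar C" "Dom C (\<Psi> X Y) = X \<boxtimes> Y" "Cod C (\<Psi> X Y) = Y \<boxtimes> X"
  using braid_iso[OF assms] by (auto simp: iso_hom_def in_hom_iff)

lemma braid_nat:
  assumes "f \<in> Ar C" "g \<in> Ar C"
  shows "\<Psi> (Cod C f) (Cod C g) \<cdot> (f \<otimes> g) = (g \<otimes> f) \<cdot> \<Psi> (Dom C f) (Dom C g)"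
  using braid_natural[of f "Dom C f" "Cod C f" g "Dom C g" "Cod C g"] assms
  by (simp add: in_hom_iff)

lemma iso_idem_ide:
  assumes "f \<in> iso_hom C X X" "f = f \<cdot> f"
  shows "f = \<iota> X"
proof -
  obtain g where g: "g \<in> Ar C" "Dom C g = X" "Cod C g = X" "g \<cdot> f = \<iota> X"
    and f: "f \<in> Ar C" "Dom C f = X" "Cod C f = X"
    using assms(1) by (auto simp: iso_hom_def in_hom_iff)
  have "f = (g \<cdot> f) \<cdot> f"
    using f g(4) by simp
  also have "\<dots> = g \<cdot> f"
    using f g(1-3) assms(2) by (metis comp_assoc_arr)
  finally show ?thesis
    using g(4) by simp
qed

text \<open>
  The hexagon at the unit object says that \<open>\<Psi> X \<one>\<close> is idempotent; being invertible, it must be the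
  identity.
\<close>

lemma braid_unit [simp]:
  assumes "X \<in> Ob C"
  shows "\<Psi> X \<one> = \<iota> X" "\<Psi> \<one> X = \<iota> X"
proof -
  show "\<Psi> X \<one> = \<iota> X"
    using braid_iso[of X \<one>] hexagon_right[of X \<one> \<one>] assms
    by (intro iso_idem_ide) simp_all
  show "\<Psi> \<one> X = \<iota> X"
    using braid_iso[of \<one> X] hexagon_left[of \<one> \<one> X] assms
    by (intro iso_idem_ide) simp_all
qed

end

locale braided_coalgebra =
  strict_braided_monoidal_category C + coalgebra_object C D \<Delta> \<epsilon>
  for C :: "('o, 'a, 'z) braided_cat_scheme" (structure) and D :: 'o and \<Delta> \<epsilon> :: 'a
begin

lemma coalg_simps [simp]:
  "D \<in> Ob C"
  "\<Delta> \<in> Ar C" "Dom C \<Delta> = D" "Cod C \<Delta> = D \<boxtimes> D"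
  "\<epsilon> \<in> Ar C" "Dom C \<epsilon> = D" "Cod C \<epsilon> = \<one>"
  using coalg_ob comult_hom counit_hom by (auto simp: in_hom_iff)

text \<open>
  The strand \<open>D\<close> is duplicated and the second copy is carried past \<open>V\<close>. Every action through the
  coproduct has the form \<open>(a \<otimes> b) \<cdot> (split_past V \<otimes> \<iota> W)\<close>, which leaves only \<open>split_past\<close> to be
  studied.
\<close>

definition split_past :: "'o \<Rightarrow> 'a" where
  "split_past V = (\<iota> D \<otimes> \<Psi> D V) \<cdot> (\<Delta> \<otimes> \<iota> V)"

lemma split_past_simps [simp]:
  assumes "V \<in> Ob C"
  shows "split_past V \<in> Ar C" "Dom C (split_past V) = D \<boxtimes> V"
    "Cod C (split_past V) = D \<boxtimes> V \<boxtimes> D"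
  using assms by (simp_all add: split_past_def)

text \<open>
  Naturality of \<open>\<Psi>\<close> alone: the second copy of \<open>D\<close> may cross \<open>V\<close> before or after \<open>f\<close> acts.
\<close>

lemma split_past_natural:
  assumes "f \<in> Ar C" "Dom C f = V" "Cod C f = W"
  shows "split_past W \<cdot> (\<iota> D \<otimes> f) = (\<iota> D \<otimes> f \<otimes> \<iota> D) \<cdot> split_past V"
proof -
  have [simp]: "V \<in> Ob C" "W \<in> Ob C"
    using assms by auto
  have "split_past W \<cdot> (\<iota> D \<otimes> f) = (\<iota> D \<otimes> \<Psi> D W) \<cdot> (\<Delta> \<otimes> f)"
    using assms by (simp add: split_past_def interchange)
  also have "\<Delta> \<otimes> f = (\<iota> D \<otimes> \<iota> D \<otimes> f) \<cdot> (\<Delta> \<otimes> \<iota> V)"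
    using assms interchange[of \<Delta> "\<iota> (D \<boxtimes> D)" "\<iota> V" f] by simp
  also have "(\<iota> D \<otimes> \<Psi> D W) \<cdot> \<dots> = (\<iota> D \<otimes> f \<otimes> \<iota> D) \<cdot> split_past V"
    using assms braid_nat[of "\<iota> D" f] by (simp add: split_past_def interchange_comp)
  finally show ?thesis .
qed

text \<open>
  Coassociativity for \<open>split_past\<close>: both sides leave copies of \<open>D\<close> before \<open>V\<close>, between \<open>V\<close> and \<open>W\<close>,
  and behind \<open>W\<close>, and they differ in which of the two copies made first is split again. Coassociativity
  of \<open>\<Delta>\<close> identifies the triple coproducts; on the right-hand side the second coproduct takes place
  behind \<open>V\<close> and has to be pulled back through the braiding first.
\<close>

lemma split_past_tensor:
  assumes [simp]: "V \<in> Ob C" "W \<in> Ob C"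
  shows "(split_past V \<otimes> \<iota> (W \<boxtimes> D)) \<cdot> split_past (V \<boxtimes> W)
    = (\<iota> D \<otimes> \<iota> V \<otimes> split_past W) \<cdot> (split_past V \<otimes> \<iota> W)"
proof -
  \<comment> \<open>A coproduct taken behind \<open>V\<close> is moved in front of \<open>V\<close> by naturality of \<open>\<Psi>\<close>, and the
    two resulting strands cross \<open>V\<close> one after the other.\<close>
  have braid: "(\<iota> V \<otimes> \<Delta>) \<cdot> \<Psi> D V = (\<Psi> D V \<otimes> \<iota> D) \<cdot> (\<iota> D \<otimes> \<Psi> D V) \<cdot> (\<Delta> \<otimes> \<iota> V)"
    using braid_nat[of \<Delta> "\<iota> V"] by (simp add: hexagon_left)
  let ?R = "(\<iota> D \<otimes> \<iota> V \<otimes> \<iota> D \<otimes> \<Psi> D W) \<cdot> (\<iota> D \<otimes> \<Psi> D V \<otimes> \<iota> (D \<boxtimes> W))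
    \<cdot> (\<iota> D \<otimes> \<iota> D \<otimes> \<Psi> D V \<otimes> \<iota> W)"
  let ?\<Delta>VW = "\<Delta> \<otimes> \<iota> (V \<boxtimes> W)"
  \<comment> \<open>Facts 3 and 4 move both coproducts ahead of all crossings, fact 5 puts the crossings
    into the order of \<open>?R\<close>.\<close>
  have 1: "split_past (V \<boxtimes> W)
      = (\<iota> D \<otimes> \<iota> V \<otimes> \<Psi> D W) \<cdot> (\<iota> D \<otimes> \<Psi> D V \<otimes> \<iota> W) \<cdot> ?\<Delta>VW"
    by (simp add: split_past_def hexagon_right whisker_left)
  have 2: "split_past V \<otimes> \<iota> (W \<boxtimes> D)
      = (\<iota> D \<otimes> \<Psi> D V \<otimes> \<iota> (W \<boxtimes> D)) \<cdot> (\<Delta> \<otimes> \<iota> (V \<boxtimes> W \<boxtimes> D))"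
    by (simp add: split_past_def whisker_right)
  have 3: "(\<Delta> \<otimes> \<iota> (V \<boxtimes> W \<boxtimes> D)) \<cdot> (\<iota> D \<otimes> \<iota> V \<otimes> \<Psi> D W)
      = (\<iota> D \<otimes> \<iota> D \<otimes> \<iota> V \<otimes> \<Psi> D W) \<cdot> (\<Delta> \<otimes> \<iota> (V \<boxtimes> D \<boxtimes> W))"
    using exchange[of \<Delta> "\<iota> V \<otimes> \<Psi> D W"] by simp
  have 4: "(\<Delta> \<otimes> \<iota> (V \<boxtimes> D \<boxtimes> W)) \<cdot> (\<iota> D \<otimes> \<Psi> D V \<otimes> \<iota> W)
      = (\<iota> D \<otimes> \<iota> D \<otimes> \<Psi> D V \<otimes> \<iota> W) \<cdot> (\<Delta> \<otimes> \<iota> (D \<boxtimes> V \<boxtimes> W))"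
    using exchange[of \<Delta> "\<Psi> D V \<otimes> \<iota> W"] by simp
  have 5: "(\<iota> D \<otimes> \<Psi> D V \<otimes> \<iota> (W \<boxtimes> D)) \<cdot> (\<iota> D \<otimes> \<iota> D \<otimes> \<iota> V \<otimes> \<Psi> D W)
    = (\<iota> D \<otimes> \<iota> V \<otimes> \<iota> D \<otimes> \<Psi> D W) \<cdot> (\<iota> D \<otimes> \<Psi> D V \<otimes> \<iota> (D \<boxtimes> W))"
    using exchange[of "\<iota> D \<otimes> \<Psi> D V" "\<Psi> D W"] by simp
  have "(split_past V \<otimes> \<iota> (W \<boxtimes> D)) \<cdot> split_past (V \<boxtimes> W)
    = ?R \<cdot> (\<Delta> \<otimes> \<iota> (D \<boxtimes> V \<boxtimes> W)) \<cdot> ?\<Delta>VW"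
    by (simp add: 1 2 comp_extend[OF 3] comp_extend[OF 4] comp_extend[OF 5])
  also have "(\<Delta> \<otimes> \<iota> (D \<boxtimes> V \<boxtimes> W)) \<cdot> ?\<Delta>VW = (\<iota> D \<otimes> \<Delta> \<otimes> \<iota> (V \<boxtimes> W)) \<cdot> ?\<Delta>VW"
    using arg_cong[OF comult_coassoc, of "\<lambda>f. f \<otimes> \<iota> (V \<boxtimes> W)"] by (simp add: whisker_right)
  also have "?R \<cdot> \<dots> = (\<iota> D \<otimes> \<iota> V \<otimes> \<iota> D \<otimes> \<Psi> D W) \<cdot>
      (\<iota> D \<otimes> ((\<Psi> D V \<otimes> \<iota> D) \<cdot> (\<iota> D \<otimes> \<Psi> D V) \<cdot> (\<Delta> \<otimes> \<iota> V)) \<otimes> \<iota> W) \<cdot> ?\<Delta>VW"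
    by (simp add: whisker_left whisker_right)
  also have "\<dots> = (\<iota> D \<otimes> \<iota> V \<otimes> split_past W) \<cdot> (split_past V \<otimes> \<iota> W)"
    by (simp flip: braid) (simp add: split_past_def whisker_left whisker_right)
  finally show ?thesis .
qed

text \<open>
  The coproduct of the tensor square coalgebra \<open>D \<boxtimes> D\<close>.
\<close>

definition comult_sq :: 'a where
  "comult_sq = (\<iota> D \<otimes> \<Psi> D D \<otimes> \<iota> D) \<cdot> (\<Delta> \<otimes> \<Delta>)"

lemma comult_sq_simps [simp]:
  "comult_sq \<in> Ar C" "Dom C comult_sq = D \<boxtimes> D" "Cod C comult_sq = D \<boxtimes> D \<boxtimes> D \<boxtimes> D"
  by (simp_all add: comult_sq_def)

lemma comult_sq_eq: "comult_sq = (split_past D \<otimes> \<iota> D) \<cdot> (\<iota> D \<otimes> \<Delta>)"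
proof -
  have "(\<Delta> \<otimes> \<iota> (D \<boxtimes> D)) \<cdot> (\<iota> D \<otimes> \<Delta>) = \<Delta> \<otimes> \<Delta>"
    by (simp add: interchange)
  then show ?thesis
    by (simp add: comult_sq_def split_past_def whisker_right)
qed

text \<open>
  The tensor square of a coalgebra is a coalgebra. By \<open>comult_sq_eq\<close> its coproduct is an instance
  of \<open>split_past\<close>, so its coassociativity is that of \<open>split_past\<close> and of \<open>\<Delta>\<close>.
\<close>

lemma comult_sq_coassoc:
  "(comult_sq \<otimes> \<iota> (D \<boxtimes> D)) \<cdot> comult_sq = (\<iota> D \<otimes> \<iota> D \<otimes> comult_sq) \<cdot> comult_sq"
proof -
  let ?s = "split_past D"
  have 1: "(\<iota> D \<otimes> \<Delta> \<otimes> \<iota> (D \<boxtimes> D)) \<cdot> (?s \<otimes> \<iota> D)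
      = (split_past (D \<boxtimes> D) \<otimes> \<iota> D) \<cdot> (\<iota> D \<otimes> \<Delta> \<otimes> \<iota> D)"
    using arg_cong[OF split_past_natural[of \<Delta> D "D \<boxtimes> D"], of "\<lambda>f. f \<otimes> \<iota> D"] by (simp add: whisker_right)
  have 2: "(\<iota> D \<otimes> \<Delta> \<otimes> \<iota> D) \<cdot> (\<iota> D \<otimes> \<Delta>) = (\<iota> D \<otimes> \<iota> D \<otimes> \<Delta>) \<cdot> (\<iota> D \<otimes> \<Delta>)"
    using arg_cong[OF comult_coassoc, of "\<lambda>f. \<iota> D \<otimes> f"] by (simp add: whisker_left)
  have 3: "(?s \<otimes> \<iota> (D \<boxtimes> D \<boxtimes> D)) \<cdot> (split_past (D \<boxtimes> D) \<otimes> \<iota> D)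
      = (\<iota> D \<otimes> \<iota> D \<otimes> ?s \<otimes> \<iota> D) \<cdot> (?s \<otimes> \<iota> (D \<boxtimes> D))"
    using arg_cong[OF split_past_tensor[of D D], of "\<lambda>f. f \<otimes> \<iota> D"] by (simp add: whisker_right)
  have 4: "(?s \<otimes> \<iota> (D \<boxtimes> D)) \<cdot> (\<iota> D \<otimes> \<iota> D \<otimes> \<Delta>) = (\<iota> D \<otimes> \<iota> D \<otimes> \<iota> D \<otimes> \<Delta>) \<cdot> (?s \<otimes> \<iota> D)"
    using exchange[of ?s \<Delta>] by simp
  show ?thesis
    by (simp add: comult_sq_eq whisker_left whisker_right comp_extend[OF 1] 2
        comp_extend[OF 3] comp_extend[OF 4])
qed

text \<open>
  The left-hand side carries the coproduct of \<open>D \<boxtimes> D\<close> past \<open>V\<close> in a single step; the hexagons allow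
  the two strands to be treated one at a time, as in an iterated action.
\<close>

lemma split_past_sq:
  assumes [simp]: "V \<in> Ob C"
  shows "(\<iota> D \<otimes> \<iota> D \<otimes> \<Psi> (D \<boxtimes> D) V) \<cdot> (comult_sq \<otimes> \<iota> V)
    = (split_past (D \<boxtimes> V) \<otimes> \<iota> D) \<cdot> (\<iota> D \<otimes> split_past V)"
proof -
  have 1: "(\<Delta> \<otimes> \<iota> (D \<boxtimes> V \<boxtimes> D)) \<cdot> (\<iota> D \<otimes> \<iota> D \<otimes> \<Psi> D V)
      = (\<iota> D \<otimes> \<iota> D \<otimes> \<iota> D \<otimes> \<Psi> D V) \<cdot> (\<Delta> \<otimes> \<iota> (D \<boxtimes> D \<boxtimes> V))"
    using exchange[of \<Delta> "\<iota> D \<otimes> \<Psi> D V"] by simp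
  have 2: "(\<iota> D \<otimes> \<Psi> D D \<otimes> \<iota> (V \<boxtimes> D)) \<cdot> (\<iota> D \<otimes> \<iota> D \<otimes> \<iota> D \<otimes> \<Psi> D V)
      = (\<iota> D \<otimes> \<iota> D \<otimes> \<iota> D \<otimes> \<Psi> D V) \<cdot> (\<iota> D \<otimes> \<Psi> D D \<otimes> \<iota> (D \<boxtimes> V))"
    using exchange[of "\<iota> D \<otimes> \<Psi> D D" "\<Psi> D V"] by simp
  have 3: "(\<Delta> \<otimes> \<iota> (D \<boxtimes> D \<boxtimes> V)) \<cdot> (\<iota> D \<otimes> \<Delta> \<otimes> \<iota> V) = \<Delta> \<otimes> \<Delta> \<otimes> \<iota> V"
    by (simp add: interchange)
  have "(split_past (D \<boxtimes> V) \<otimes> \<iota> D) \<cdot> (\<iota> D \<otimes> split_past V)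
      = (\<iota> D \<otimes> \<iota> D \<otimes> \<Psi> D V \<otimes> \<iota> D) \<cdot> (\<iota> D \<otimes> \<iota> D \<otimes> \<iota> D \<otimes> \<Psi> D V)
        \<cdot> (\<iota> D \<otimes> \<Psi> D D \<otimes> \<iota> (D \<boxtimes> V)) \<cdot> (\<Delta> \<otimes> \<Delta> \<otimes> \<iota> V)"
    by (simp add: split_past_def hexagon_right whisker_left whisker_right
        comp_extend[OF 1] comp_extend[OF 2] 3)
  then show ?thesis
    by (simp add: comult_sq_def hexagon_left whisker_left whisker_right)
qed

lemma tensor_mod_eq:
  assumes "V \<in> Ob C" "W \<in> Ob C"
    and "a \<in> Ar C" "b \<in> Ar C" "Dom C a = D \<boxtimes> V" "Dom C b = D \<boxtimes> W"
  shows "tensor_mod C D \<Delta> (V, a) (W, b) = (V \<boxtimes> W, (a \<otimes> b) \<cdot> (split_past V \<otimes> \<iota> W))"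
  using assms by (simp add: tensor_mod_def split_past_def whisker_right)

text \<open>
  The two underlying actions differ only in how the three copies of \<open>D\<close> are produced, which is
  settled by \<open>split_past_tensor\<close>. The actions are arbitrary arrows, so that the equation applies
  when the last one belongs to a module over a different algebra structure on \<open>D\<close>.
\<close>

lemma tensor_mod_assoc:
  assumes [simp]: "V \<in> Ob C" "W \<in> Ob C" "X \<in> Ob C"
    and a [simp]: "a \<in> Ar C" "Dom C a = D \<boxtimes> V" "Cod C a = V"
    and b [simp]: "b \<in> Ar C" "Dom C b = D \<boxtimes> W" "Cod C b = W"
    and c [simp]: "c \<in> Ar C" "Dom C c = D \<boxtimes> X" "Cod C c = X"
  shows "tensor_mod C D \<Delta> (tensor_mod C D \<Delta> (V, a) (W, b)) (X, c)
    = tensor_mod C D \<Delta> (V, a) (tensor_mod C D \<Delta> (W, b) (X, c))"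
proof -
  have 1: "((a \<otimes> b) \<cdot> (split_past V \<otimes> \<iota> W)) \<otimes> c
      = (a \<otimes> b \<otimes> c) \<cdot> (split_past V \<otimes> \<iota> (W \<boxtimes> D \<boxtimes> X))"
    using interchange[of "split_past V \<otimes> \<iota> W" "a \<otimes> b" "\<iota> (D \<boxtimes> X)" c] by simp
  have 2: "a \<otimes> ((b \<otimes> c) \<cdot> (split_past W \<otimes> \<iota> X))
      = (a \<otimes> b \<otimes> c) \<cdot> (\<iota> D \<otimes> \<iota> V \<otimes> split_past W \<otimes> \<iota> X)"
    using interchange[of "\<iota> (D \<boxtimes> V)" a "split_past W \<otimes> \<iota> X" "b \<otimes> c"] by simp
  have 3: "(split_past V \<otimes> \<iota> (W \<boxtimes> D \<boxtimes> X)) \<cdot> (split_past (V \<boxtimes> W) \<otimes> \<iota> X)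
      = (\<iota> D \<otimes> \<iota> V \<otimes> split_past W \<otimes> \<iota> X) \<cdot> (split_past V \<otimes> \<iota> (W \<boxtimes> X))"
    using arg_cong[OF split_past_tensor[of V W], of "\<lambda>f. f \<otimes> \<iota> X"] by (simp add: whisker_right)
  show ?thesis
    by (simp add: tensor_mod_eq 1 2 3)
qed

lemma tensor_mod_unit:
  assumes [simp]: "V \<in> Ob C" "a \<in> Ar C" "Dom C a = D \<boxtimes> V"
  shows "tensor_mod C D \<Delta> (triv_mod C \<epsilon>) (V, a) = (V, a)"
    and "tensor_mod C D \<Delta> (V, a) (triv_mod C \<epsilon>) = (V, a)"
proof -
  have "\<epsilon> \<otimes> a = a \<cdot> (\<epsilon> \<otimes> \<iota> (D \<boxtimes> V))"
    using interchange[of \<epsilon> "\<iota> \<one>" "\<iota> (D \<boxtimes> V)" a] by simp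
  then have "(\<epsilon> \<otimes> a) \<cdot> (\<Delta> \<otimes> \<iota> V) = a \<cdot> (((\<epsilon> \<otimes> \<iota> D) \<cdot> \<Delta>) \<otimes> \<iota> V)"
    by (simp add: whisker_right)
  then show "tensor_mod C D \<Delta> (triv_mod C \<epsilon>) (V, a) = (V, a)"
    by (simp add: triv_mod_def tensor_mod_eq split_past_def comult_counit_left)
  have 1: "(\<iota> V \<otimes> \<epsilon>) \<cdot> \<Psi> D V = \<epsilon> \<otimes> \<iota> V"
    using braid_nat[of \<epsilon> "\<iota> V"] by simp
  have 2: "a \<otimes> \<epsilon> = a \<cdot> (\<iota> D \<otimes> \<iota> V \<otimes> \<epsilon>)"
    using interchange[of "\<iota> (D \<boxtimes> V)" a \<epsilon> "\<iota> \<one>"] by simp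
  have "(a \<otimes> \<epsilon>) \<cdot> split_past V = a \<cdot> (\<iota> D \<otimes> ((\<iota> V \<otimes> \<epsilon>) \<cdot> \<Psi> D V)) \<cdot> (\<Delta> \<otimes> \<iota> V)"
    by (simp add: 2 split_past_def whisker_left)
  also have "\<dots> = a \<cdot> (((\<iota> D \<otimes> \<epsilon>) \<cdot> \<Delta>) \<otimes> \<iota> V)"
    unfolding 1 by (simp add: whisker_right)
  finally show "tensor_mod C D \<Delta> (V, a) (triv_mod C \<epsilon>) = (V, a)"
    by (simp add: triv_mod_def tensor_mod_eq comult_counit_right)
qed

lemma tensor_equivariant:
  assumes [simp]: "a \<in> Ar C" "Dom C a = D \<boxtimes> V" "Cod C a = V"
      "a' \<in> Ar C" "Dom C a' = D \<boxtimes> V'" "Cod C a' = V'"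
      "b \<in> Ar C" "Dom C b = D \<boxtimes> W" "Cod C b = W"
      "b' \<in> Ar C" "Dom C b' = D \<boxtimes> W'" "Cod C b' = W'"
      "f \<in> Ar C" "Dom C f = V" "Cod C f = V'"
      "g \<in> Ar C" "Dom C g = W" "Cod C g = W'"
    and f: "f \<cdot> a = a' \<cdot> (\<iota> D \<otimes> f)"
    and g: "g \<cdot> b = b' \<cdot> (\<iota> D \<otimes> g)"
  shows "(f \<otimes> g) \<cdot> (a \<otimes> b) \<cdot> (split_past V \<otimes> \<iota> W)
    = ((a' \<otimes> b') \<cdot> (split_past V' \<otimes> \<iota> W')) \<cdot> (\<iota> D \<otimes> f \<otimes> g)"
proof -
  have [simp]: "V \<in> Ob C" "V' \<in> Ob C" "W \<in> Ob C" "W' \<in> Ob C"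
    using Dom_Ob[of f] Cod_Ob[of f] Dom_Ob[of g] Cod_Ob[of g] by simp_all
  have 1: "(split_past V' \<otimes> \<iota> W') \<cdot> (\<iota> D \<otimes> f \<otimes> g)
      = (\<iota> D \<otimes> f \<otimes> \<iota> D \<otimes> g) \<cdot> (split_past V \<otimes> \<iota> W)"
    using interchange[of "\<iota> D \<otimes> f" "split_past V'" g "\<iota> W'"]
      interchange[of "split_past V" "\<iota> D \<otimes> f \<otimes> \<iota> D" "\<iota> W" g]
    by (simp add: split_past_natural)
  have 2: "(a' \<otimes> b') \<cdot> (\<iota> D \<otimes> f \<otimes> \<iota> D \<otimes> g) = (f \<otimes> g) \<cdot> (a \<otimes> b)"
    using interchange[of "\<iota> D \<otimes> f" a' "\<iota> D \<otimes> g" b'] by (simp add: interchange f g)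
  show ?thesis
    by (simp add: 1 comp_extend[OF 2])
qed

end

section \<open>Twisting the product of a bialgebra\<close>

text \<open>
  The extra axiom says that \<open>\<Delta>\<close> makes the algebra \<open>(B, n, u)\<close> a left comodule algebra over the
  bialgebra \<open>(B, m, u, \<Delta>, \<epsilon>)\<close>. It covers both cases of interest: \<open>n = m\<close>, where it is the bialgebra
  axiom, and \<open>n\<close> the twist of \<open>m\<close> by a right 2-cocycle.
\<close>

locale twisted_bialgebra = bialgebra C B m u \<Delta> \<epsilon> + twist: algebra_object C B n u
  for C :: "('o, 'a, 'z) braided_cat_scheme" (structure)
    and B :: 'o and m u \<Delta> \<epsilon> n :: 'a +
  assumes comult_twist: "\<Delta> \<cdot> n = (m \<otimes> n) \<cdot> (\<iota> B \<otimes> \<Psi> B B \<otimes> \<iota> B) \<cdot> (\<Delta> \<otimes> \<Delta>)"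
begin

sublocale braided_coalgebra C B \<Delta> \<epsilon> ..

lemma alg_simps [simp]:
  "m \<in> Ar C" "Dom C m = B \<boxtimes> B" "Cod C m = B"
  "n \<in> Ar C" "Dom C n = B \<boxtimes> B" "Cod C n = B"
  "u \<in> Ar C" "Dom C u = \<one>" "Cod C u = B"
  using mult_hom unit_hom twist.mult_hom by (auto simp: in_hom_iff)

text \<open>
  Splitting a product \<open>n\<close> yields a product \<open>m\<close> of the first copies and a product \<open>n\<close> of the second
  ones, hence a \<open>B\<close>-module is needed in the first tensor factor and a module for \<open>n\<close> in the second.
  The product \<open>n\<close> is moved past \<open>V\<close> by naturality of the braiding.
\<close>

lemma split_past_mult:
  assumes [simp]: "V \<in> Ob C"
  shows "split_past V \<cdot> (n \<otimes> \<iota> V)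
    = (m \<otimes> \<iota> V \<otimes> n) \<cdot> (split_past (B \<boxtimes> V) \<otimes> \<iota> B) \<cdot> (\<iota> B \<otimes> split_past V)"
proof -
  have "split_past V \<cdot> (n \<otimes> \<iota> V) = (\<iota> B \<otimes> \<Psi> B V) \<cdot> ((\<Delta> \<cdot> n) \<otimes> \<iota> V)"
    by (simp add: split_past_def whisker_right)
  also have "\<dots> = (\<iota> B \<otimes> \<Psi> B V) \<cdot> (m \<otimes> n \<otimes> \<iota> V) \<cdot> (comult_sq \<otimes> \<iota> V)"
    unfolding comult_twist comult_sq_def[symmetric] by (simp add: whisker_right)
  also have "(\<iota> B \<otimes> \<Psi> B V) \<cdot> (m \<otimes> n \<otimes> \<iota> V) \<cdot> (comult_sq \<otimes> \<iota> V)
      = (m \<otimes> \<iota> V \<otimes> n) \<cdot> (\<iota> B \<otimes> \<iota> B \<otimes> \<Psi> (B \<boxtimes> B) V) \<cdot> (comult_sq \<otimes> \<iota> V)"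
  proof (rule comp_extend)
    show "(\<iota> B \<otimes> \<Psi> B V) \<cdot> (m \<otimes> n \<otimes> \<iota> V) = (m \<otimes> \<iota> V \<otimes> n) \<cdot> (\<iota> B \<otimes> \<iota> B \<otimes> \<Psi> (B \<boxtimes> B) V)"
      using braid_nat[of n "\<iota> V"] interchange[of "\<iota> (B \<boxtimes> B)" m "\<Psi> (B \<boxtimes> B) V" "\<iota> V \<otimes> n"]
      by (simp add: interchange)
  qed simp_all
  also have "\<dots> = (m \<otimes> \<iota> V \<otimes> n) \<cdot> (split_past (B \<boxtimes> V) \<otimes> \<iota> B) \<cdot> (\<iota> B \<otimes> split_past V)"
    by (simp only: split_past_sq assms)
  finally show ?thesis .
qed

lemma split_past_unit:
  assumes [simp]: "V \<in> Ob C"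
  shows "split_past V \<cdot> (u \<otimes> \<iota> V) = u \<otimes> \<iota> V \<otimes> u"
proof -
  have "split_past V \<cdot> (u \<otimes> \<iota> V) = (\<iota> B \<otimes> \<Psi> B V) \<cdot> ((\<Delta> \<cdot> u) \<otimes> \<iota> V)"
    by (simp add: split_past_def whisker_right)
  also have "\<dots> = u \<otimes> (\<Psi> B V \<cdot> (u \<otimes> \<iota> V))"
    by (simp add: comult_unit interchange)
  finally show ?thesis
    using braid_nat[of u "\<iota> V"] by simp
qed

lemma module_simps:
  assumes "left_module C B k u V a"
  shows "V \<in> Ob C" "a \<in> Ar C" "Dom C a = B \<boxtimes> V" "Cod C a = V"
  using left_module.module_ob[OF assms] left_module.act_hom[OF assms] by (auto simp: in_hom_iff)

text \<open>
  Acting with a product splits into \<open>a \<cdot> (m \<otimes> \<iota> V)\<close> and \<open>b \<cdot> (n \<otimes> \<iota> W)\<close> (\<open>split_past_mult\<close>); the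
  module axioms of the two factors turn these into iterated actions, and naturality of
  \<open>split_past\<close> reassembles them into the iterated action on \<open>V \<boxtimes> W\<close>.
\<close>

lemma tensor_left_module:
  assumes V: "left_module C B m u V a" and W: "left_module C B n u W b"
  shows "left_module C B n u (V \<boxtimes> W) ((a \<otimes> b) \<cdot> (split_past V \<otimes> \<iota> W))"
proof
  note [simp] = module_simps[OF V] module_simps[OF W]
  let ?c = "(a \<otimes> b) \<cdot> (split_past V \<otimes> \<iota> W)"
  show "V \<boxtimes> W \<in> Ob C" "?c \<in> hom C (B \<boxtimes> V \<boxtimes> W) (V \<boxtimes> W)"
    by (simp_all add: in_hom_iff)
  let ?t = "(split_past (B \<boxtimes> V) \<otimes> \<iota> (B \<boxtimes> W)) \<cdot> (\<iota> B \<otimes> split_past V \<otimes> \<iota> W)"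
  have 1: "(split_past V \<otimes> \<iota> W) \<cdot> (n \<otimes> \<iota> (V \<boxtimes> W)) = (m \<otimes> \<iota> V \<otimes> n \<otimes> \<iota> W) \<cdot> ?t"
    using arg_cong[OF split_past_mult[of V], of "\<lambda>f. f \<otimes> \<iota> W"] by (simp add: whisker_right)
  have 2: "(split_past V \<otimes> \<iota> W) \<cdot> (\<iota> B \<otimes> a \<otimes> b)
      = (\<iota> B \<otimes> a \<otimes> \<iota> B \<otimes> b) \<cdot> (split_past (B \<boxtimes> V) \<otimes> \<iota> (B \<boxtimes> W))"
    using interchange[of "\<iota> B \<otimes> a" "split_past V" b "\<iota> W"]
      interchange[of "split_past (B \<boxtimes> V)" "\<iota> B \<otimes> a \<otimes> \<iota> B" "\<iota> (B \<boxtimes> W)" b]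
    by (simp add: split_past_natural)
  have 3: "(a \<otimes> b) \<cdot> (m \<otimes> \<iota> V \<otimes> n \<otimes> \<iota> W) = (a \<otimes> b) \<cdot> (\<iota> B \<otimes> a \<otimes> \<iota> B \<otimes> b)"
    using interchange[of "m \<otimes> \<iota> V" a "n \<otimes> \<iota> W" b] interchange[of "\<iota> B \<otimes> a" a "\<iota> B \<otimes> b" b]
    by (simp add: left_module.act_mult[OF V] left_module.act_mult[OF W])
  have "?c \<cdot> (n \<otimes> \<iota> (V \<boxtimes> W)) = (a \<otimes> b) \<cdot> (m \<otimes> \<iota> V \<otimes> n \<otimes> \<iota> W) \<cdot> ?t"
    by (simp add: 1)
  also have "\<dots> = (a \<otimes> b) \<cdot> (\<iota> B \<otimes> a \<otimes> \<iota> B \<otimes> b) \<cdot> ?t"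
    by (simp add: comp_extend[OF 3])
  also have "\<dots> = ?c \<cdot> (\<iota> B \<otimes> ?c)"
    by (simp add: whisker_left comp_extend[OF 2])
  finally show "?c \<cdot> (n \<otimes> \<iota> (V \<boxtimes> W)) = ?c \<cdot> (\<iota> B \<otimes> ?c)" .
  have "(split_past V \<otimes> \<iota> W) \<cdot> (u \<otimes> \<iota> (V \<boxtimes> W)) = u \<otimes> \<iota> V \<otimes> u \<otimes> \<iota> W"
    using arg_cong[OF split_past_unit[of V], of "\<lambda>f. f \<otimes> \<iota> W"] by (simp add: whisker_right)
  then show "?c \<cdot> (u \<otimes> \<iota> (V \<boxtimes> W)) = \<iota> (V \<boxtimes> W)"
    using interchange[of "u \<otimes> \<iota> V" a "u \<otimes> \<iota> W" b]
    by (simp add: left_module.act_unit[OF V] left_module.act_unit[OF W])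
qed

end

context right_two_cocycle
begin

sublocale braided_coalgebra C B \<Delta> \<epsilon> ..

lemma twisted_mult_eq: "twisted_mult C B m \<Delta> \<sigma> = (m \<otimes> \<sigma>) \<cdot> comult_sq"
  by (simp add: twisted_mult_def comult_sq_def)

text \<open>
  The twisted product multiplies the first output \<open>B \<boxtimes> B\<close> of \<open>comult_sq\<close> and feeds the second to \<open>\<sigma>\<close>.
  Splitting the product once more gives three copies of \<open>B \<boxtimes> B\<close>, with \<open>m\<close>, \<open>m\<close> and \<open>\<sigma>\<close> applied to
  them; by coassociativity the last two combine to a twisted product. The cocycle sits at the
  right end throughout, which is why the untwisted \<open>m\<close> remains on the left.
\<close>

lemma comult_twisted_mult:
  "\<Delta> \<cdot> twisted_mult C B m \<Delta> \<sigma> = (m \<otimes> twisted_mult C B m \<Delta> \<sigma>) \<cdot> comult_sq"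
proof -
  have [simp]: "m \<in> Ar C" "Dom C m = B \<boxtimes> B" "Cod C m = B"
    "\<sigma> \<in> Ar C" "Dom C \<sigma> = B \<boxtimes> B" "Cod C \<sigma> = \<one>"
    using mult_hom cocycle_hom by (auto simp: in_hom_iff)
  have "\<Delta> \<cdot> (m \<otimes> \<sigma>) = (\<Delta> \<cdot> m) \<otimes> \<sigma>"
    using interchange[of m \<Delta> \<sigma> "\<iota> \<one>"] by simp
  also have "\<Delta> \<cdot> m = (m \<otimes> m) \<cdot> comult_sq"
    by (simp add: comult_mult comult_sq_def)
  also have "\<dots> \<otimes> \<sigma> = (m \<otimes> m \<otimes> \<sigma>) \<cdot> (comult_sq \<otimes> \<iota> (B \<boxtimes> B))"
    using interchange[of comult_sq "m \<otimes> m" "\<iota> (B \<boxtimes> B)" \<sigma>] by simp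
  finally have 1: "\<Delta> \<cdot> (m \<otimes> \<sigma>) = \<dots>" .
  have 2: "m \<otimes> ((m \<otimes> \<sigma>) \<cdot> comult_sq) = (m \<otimes> m \<otimes> \<sigma>) \<cdot> (\<iota> B \<otimes> \<iota> B \<otimes> comult_sq)"
    using interchange[of "\<iota> (B \<boxtimes> B)" m comult_sq "m \<otimes> \<sigma>"] by simp
  show ?thesis
    by (simp add: twisted_mult_eq comp_extend[OF 1] 2 comult_sq_coassoc)
qed

lemma twisted_bialgebra: "twisted_bialgebra C B m u \<Delta> \<epsilon> (twisted_mult C B m \<Delta> \<sigma>)"
  using comult_twisted_mult twist_algebra
  by (intro twisted_bialgebra.intro twisted_bialgebra_axioms.intro)
    (simp_all add: comult_sq_def bialgebra_axioms)

end

section \<open>Strict tensor products and strict actions\<close>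

text \<open>
  When the constraints are identities, their naturality is strict associativity and unitality of
  the tensor product of arrows, and both sides of the pentagon and of the triangle are identities.
\<close>

lemma strict_monoidal_categoryI:
  fixes C :: "('o, 'a, 'z) mon_cat_scheme" (structure)
  assumes "category C"
    and bifunctor: "cat_functor (prod_cat C C) C (\<lambda>(X, Y). X \<boxtimes> Y) (\<lambda>(f, g). f \<otimes> g)"
    and unit: "\<one> \<in> Ob C"
    and ob: "\<And>X Y Z. \<lbrakk>X \<in> Ob C; Y \<in> Ob C; Z \<in> Ob C\<rbrakk> \<Longrightarrow> (X \<boxtimes> Y) \<boxtimes> Z = X \<boxtimes> Y \<boxtimes> Z"
      "\<And>X. X \<in> Ob C \<Longrightarrow> \<one> \<boxtimes> X = X" "\<And>X. X \<in> Ob C \<Longrightarrow> X \<boxtimes> \<one> = X"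
    and ar: "\<And>f g h. \<lbrakk>f \<in> Ar C; g \<in> Ar C; h \<in> Ar C\<rbrakk> \<Longrightarrow> (f \<otimes> g) \<otimes> h = f \<otimes> g \<otimes> h"
      "\<And>f. f \<in> Ar C \<Longrightarrow> \<iota> \<one> \<otimes> f = f" "\<And>f. f \<in> Ar C \<Longrightarrow> f \<otimes> \<iota> \<one> = f"
    and constraint:
      "\<And>X Y Z. \<lbrakk>X \<in> Ob C; Y \<in> Ob C; Z \<in> Ob C\<rbrakk> \<Longrightarrow> Assoc C X Y Z = \<iota> (X \<boxtimes> Y \<boxtimes> Z)"
      "\<And>X. X \<in> Ob C \<Longrightarrow> LUnit C X = \<iota> X" "\<And>X. X \<in> Ob C \<Longrightarrow> RUnit C X = \<iota> X"
  shows "strict_monoidal_category C"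
proof -
  interpret category C by fact
  have tensor [simp]: "X \<boxtimes> Y \<in> Ob C" "\<iota> X \<otimes> \<iota> Y = \<iota> (X \<boxtimes> Y)" if "X \<in> Ob C" "Y \<in> Ob C" for X Y
    using cat_functor.ob_closed[OF bifunctor, of "(X, Y)"]
      cat_functor.preserves_ide[OF bifunctor, of "(X, Y)"] that
    by (simp_all add: prod_cat_def)
  have tensor_ar [simp]: "f \<otimes> g \<in> Ar C" "Dom C (f \<otimes> g) = Dom C f \<boxtimes> Dom C g"
      "Cod C (f \<otimes> g) = Cod C f \<boxtimes> Cod C g" if "f \<in> Ar C" "g \<in> Ar C" for f g
    using cat_functor.hom_closed[OF bifunctor,
        of "(f, g)" "(Dom C f, Dom C g)" "(Cod C f, Cod C g)"] that
    by (auto simp: prod_cat_def hom_def)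
  show ?thesis
    by (intro strict_monoidal_category.intro monoidal_category.intro
        monoidal_category_axioms.intro strict_monoidal_category_axioms.intro)
      (use assms(1,2) in \<open>auto simp: unit ob ar constraint in_hom_iff intro: ide_iso_hom\<close>)
qed

lemma strict_left_module_categoryI:
  assumes "strict_monoidal_category C" and "category M"
    and bifunctor: "cat_functor (prod_cat C M) M (\<lambda>(X, P). AO X P) (\<lambda>(f, p). AA f p)"
    and ob: "\<And>X Y P. \<lbrakk>X \<in> Ob C; Y \<in> Ob C; P \<in> Ob M\<rbrakk>
        \<Longrightarrow> AO (TensOb C X Y) P = AO X (AO Y P)"
      "\<And>P. P \<in> Ob M \<Longrightarrow> AO (Unit C) P = P"
    and ar: "\<And>f g p. \<lbrakk>f \<in> Ar C; g \<in> Ar C; p \<in> Ar M\<rbrakk>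
        \<Longrightarrow> AA (TensAr C f g) p = AA f (AA g p)"
      "\<And>p. p \<in> Ar M \<Longrightarrow> AA (Ide C (Unit C)) p = p"
    and constraint: "\<And>X Y P. \<lbrakk>X \<in> Ob C; Y \<in> Ob C; P \<in> Ob M\<rbrakk>
        \<Longrightarrow> \<mu> X Y P = Ide M (AO X (AO Y P))"
      "\<And>P. P \<in> Ob M \<Longrightarrow> \<eta> P = Ide M P"
  shows "left_module_category C M AO AA \<mu> \<eta>"
proof -
  interpret C: strict_monoidal_category C by fact
  interpret M: category M by fact
  have act [simp]: "AO X P \<in> Ob M" "AA (Ide C X) (Ide M P) = Ide M (AO X P)"
    if "X \<in> Ob C" "P \<in> Ob M" for X P
    using cat_functor.ob_closed[OF bifunctor, of "(X, P)"]
      cat_functor.preserves_ide[OF bifunctor, of "(X, P)"] that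
    by (simp_all add: prod_cat_def)
  have act_ar [simp]: "AA f p \<in> Ar M" "Dom M (AA f p) = AO (Dom C f) (Dom M p)"
      "Cod M (AA f p) = AO (Cod C f) (Cod M p)" if "f \<in> Ar C" "p \<in> Ar M" for f p
    using cat_functor.hom_closed[OF bifunctor,
        of "(f, p)" "(Dom C f, Dom M p)" "(Cod C f, Cod M p)"] that
    by (auto simp: prod_cat_def hom_def)
  show ?thesis
    by (intro left_module_category.intro left_module_category_axioms.intro)
      (use assms(2,3) C.monoidal_category_axioms in \<open>auto simp: ob ar constraint C.in_hom_iff M.in_hom_iff C.assoc_strict
          C.runit_strict intro: M.ide_iso_hom\<close>)
qed

section \<open>The categories of modules\<close>

lemma category_prod_cat:
  assumes "category C" "category D"
  shows "category (prod_cat C D)"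
proof -
  interpret C: category C by fact
  interpret D: category D by fact
  show ?thesis
    by unfold_locales (auto simp: prod_cat_def hom_def)
qed

lemma Mod_simps:
  "X \<in> Ob (Mod C A m u) \<longleftrightarrow> left_module C A m u (fst X) (snd X)"
  "F \<in> hom (Mod C A m u) X Y \<longleftrightarrow> (\<exists>f. F = (X, Y, f) \<and>
     left_module C A m u (fst X) (snd X) \<and> left_module C A m u (fst Y) (snd Y) \<and>
     f \<in> hom C (fst X) (fst Y) \<and> Comp C f (snd X) = Comp C (snd Y) (TensAr C (Ide C A) f))"
  "Ide (Mod C A m u) X = (X, X, Ide C (fst X))"
  "Comp (Mod C A m u) (Y', Z, g) (X, Y, f) = (X, Z, Comp C g f)"
  by (auto simp: Mod_def hom_def)

lemma (in algebra_object) Mod_category: "category (Mod C A m u)"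
proof
  fix F assume "F \<in> Ar (Mod C A m u)"
  then show "Dom (Mod C A m u) F \<in> Ob (Mod C A m u)" "Cod (Mod C A m u) F \<in> Ob (Mod C A m u)"
    by (auto simp: Mod_def)
next
  have module: "V \<in> Ob C \<and> a \<in> Ar C \<and> Dom C a = A \<boxtimes> V \<and> Cod C a = V"
    if "left_module C A m u V a" for V a
    using left_module.module_ob[OF that] left_module.act_hom[OF that] by (simp add: in_hom_iff)
  note [simp] = alg_ob
  show "Ide (Mod C A m u) X \<in> hom (Mod C A m u) X X" if "X \<in> Ob (Mod C A m u)" for X
    using that by (auto simp: Mod_simps in_hom_iff dest!: module)
  show "Comp (Mod C A m u) G F \<in> hom (Mod C A m u) X Z"
    if FG: "F \<in> hom (Mod C A m u) X Y" "G \<in> hom (Mod C A m u) Y Z" for F G X Y Z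
  proof -
    obtain f g where F: "F = (X, Y, f)" and G: "G = (Y, Z, g)"
      and X: "left_module C A m u (fst X) (snd X)" and Y: "left_module C A m u (fst Y) (snd Y)"
      and Z: "left_module C A m u (fst Z) (snd Z)"
      and [simp]: "f \<in> Ar C" "Dom C f = fst X" "Cod C f = fst Y"
        "g \<in> Ar C" "Dom C g = fst Y" "Cod C g = fst Z"
      and f: "f \<cdot> snd X = snd Y \<cdot> (\<iota> A \<otimes> f)" and g: "g \<cdot> snd Y = snd Z \<cdot> (\<iota> A \<otimes> g)"
      using FG by (auto simp: Mod_simps in_hom_iff)
    note [simp] = module[OF X] module[OF Y] module[OF Z]
    have "(g \<cdot> f) \<cdot> snd X = snd Z \<cdot> (\<iota> A \<otimes> (g \<cdot> f))"
      by (simp add: f comp_extend[OF g] whisker_left)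
    then show ?thesis
      using X Z by (simp add: F G Mod_simps in_hom_iff)
  qed
  show "Comp (Mod C A m u) F (Ide (Mod C A m u) X) = F"
      "Comp (Mod C A m u) (Ide (Mod C A m u) Y) F = F"
    if "F \<in> hom (Mod C A m u) X Y" for F X Y
    using that by (auto simp: Mod_simps in_hom_iff)
  show "Comp (Mod C A m u) (Comp (Mod C A m u) H G) F = Comp (Mod C A m u) H (Comp (Mod C A m u) G F)"
    if "F \<in> hom (Mod C A m u) W X" "G \<in> hom (Mod C A m u) X Y" "H \<in> hom (Mod C A m u) Y Z"
    for F G H W X Y Z
    using that by (auto simp: Mod_simps in_hom_iff)
qed

text \<open>
  The monoidal category of modules extends the record of its underlying category, so the two have
  the same categorical data although they are different records of different types.
\<close>

lemma Mod_monoidal_simps [simp]: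
  "Ob (Mod_monoidal C B m u \<Delta> \<epsilon>) = Ob (Mod C B m u)"
  "Ar (Mod_monoidal C B m u \<Delta> \<epsilon>) = Ar (Mod C B m u)"
  "Dom (Mod_monoidal C B m u \<Delta> \<epsilon>) = Dom (Mod C B m u)"
  "Cod (Mod_monoidal C B m u \<Delta> \<epsilon>) = Cod (Mod C B m u)"
  "Ide (Mod_monoidal C B m u \<Delta> \<epsilon>) = Ide (Mod C B m u)"
  "Comp (Mod_monoidal C B m u \<Delta> \<epsilon>) = Comp (Mod C B m u)"
  "hom (Mod_monoidal C B m u \<Delta> \<epsilon>) = hom (Mod C B m u)"
  "TensOb (Mod_monoidal C B m u \<Delta> \<epsilon>) = tensor_mod C B \<Delta>"
  "TensAr (Mod_monoidal C B m u \<Delta> \<epsilon>) = tensor_mod_ar C B \<Delta>"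
  "Unit (Mod_monoidal C B m u \<Delta> \<epsilon>) = triv_mod C \<epsilon>"
  "Assoc (Mod_monoidal C B m u \<Delta> \<epsilon>) = mod_assoc C B \<Delta>"
  "LUnit (Mod_monoidal C B m u \<Delta> \<epsilon>) = mod_lunit C B \<Delta> \<epsilon>"
  "RUnit (Mod_monoidal C B m u \<Delta> \<epsilon>) = mod_runit C B \<Delta> \<epsilon>"
  by (simp_all add: Mod_monoidal_def cat.defs mon_cat.defs hom_def fun_eq_iff)

lemma category_Mod_monoidal_iff: "category (Mod_monoidal C B m u \<Delta> \<epsilon>) \<longleftrightarrow> category (Mod C B m u)"
  by (simp add: category_def)

lemma prod_cat_Mod_monoidal:
  "prod_cat (Mod_monoidal C B m u \<Delta> \<epsilon>) M = prod_cat (Mod C B m u) M"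
  "prod_cat M (Mod_monoidal C B m u \<Delta> \<epsilon>) = prod_cat M (Mod C B m u)"
  by (simp_all add: prod_cat_def)

lemma fst_tensor_mod: "fst (tensor_mod C B \<Delta> X Y) = TensOb C (fst X) (fst Y)"
  by (simp add: tensor_mod_def split_beta)

context twisted_bialgebra
begin

lemma tensor_mod_Ob:
  assumes "X \<in> Ob (Mod C B m u)" "Y \<in> Ob (Mod C B n u)"
  shows "tensor_mod C B \<Delta> X Y \<in> Ob (Mod C B n u)"
  using assms tensor_left_module[of "fst X" "snd X" "fst Y" "snd Y"]
    tensor_mod_eq[of "fst X" "fst Y" "snd X" "snd Y"]
  by (auto simp: Mod_simps module_simps)

lemma tensor_mod_bifunctor:
  "cat_functor (prod_cat (Mod C B m u) (Mod C B n u)) (Mod C B n u)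
     (\<lambda>(X, Y). tensor_mod C B \<Delta> X Y) (\<lambda>(f, g). tensor_mod_ar C B \<Delta> f g)"
proof (intro cat_functor.intro cat_functor_axioms.intro category_prod_cat Mod_category
    twist.Mod_category)
  let ?M = "Mod C B m u" and ?N = "Mod C B n u"
  have hom_prod: "F \<in> hom (prod_cat ?M ?N) X Y
      \<longleftrightarrow> fst F \<in> hom ?M (fst X) (fst Y) \<and> snd F \<in> hom ?N (snd X) (snd Y)" for F X Y
    by (cases F; cases X; cases Y) (auto simp: prod_cat_def hom_def)
  show "(case X of (X, Y) \<Rightarrow> tensor_mod C B \<Delta> X Y) \<in> Ob ?N" if "X \<in> Ob (prod_cat ?M ?N)" for X
    using that tensor_mod_Ob by (auto simp: prod_cat_def)
  show "(case F of (f, g) \<Rightarrow> tensor_mod_ar C B \<Delta> f g)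
      \<in> hom ?N (case X of (X, Y) \<Rightarrow> tensor_mod C B \<Delta> X Y) (case Y of (X, Y) \<Rightarrow> tensor_mod C B \<Delta> X Y)"
    if FXY: "F \<in> hom (prod_cat ?M ?N) X Y" for F X Y
  proof -
    obtain V a W b V' a' W' b' where XY: "X = ((V, a), (W, b))" "Y = ((V', a'), (W', b'))"
      by (metis surj_pair)
    obtain f g where F: "F = (((V, a), (V', a'), f), ((W, b), (W', b'), g))"
      and V: "left_module C B m u V a" and V': "left_module C B m u V' a'"
      and W: "left_module C B n u W b" and W': "left_module C B n u W' b'"
      and [simp]: "f \<in> Ar C" "Dom C f = V" "Cod C f = V'" "g \<in> Ar C" "Dom C g = W" "Cod C g = W'"
      and f: "f \<cdot> a = a' \<cdot> (\<iota> B \<otimes> f)" and g: "g \<cdot> b = b' \<cdot> (\<iota> B \<otimes> g)"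
      using FXY unfolding hom_prod XY by (cases F) (auto simp: Mod_simps in_hom_iff)
    note [simp] = module_simps[OF V] module_simps[OF V'] module_simps[OF W] module_simps[OF W']
    show ?thesis
      using tensor_left_module[OF V W] tensor_left_module[OF V' W']
        tensor_equivariant[of a V a' V' b W b' W' f g] f g
      by (simp add: F XY tensor_mod_ar_def tensor_mod_eq Mod_simps in_hom_iff)
  qed
  show "(case Ide (prod_cat ?M ?N) X of (f, g) \<Rightarrow> tensor_mod_ar C B \<Delta> f g)
      = Ide ?N (case X of (X, Y) \<Rightarrow> tensor_mod C B \<Delta> X Y)" if "X \<in> Ob (prod_cat ?M ?N)" for X
    using that
    by (auto simp: prod_cat_def Mod_simps tensor_mod_ar_def fst_tensor_mod module_simps)
  show "(case Comp (prod_cat ?M ?N) G F of (f, g) \<Rightarrow> tensor_mod_ar C B \<Delta> f g)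
      = Comp ?N (case G of (f, g) \<Rightarrow> tensor_mod_ar C B \<Delta> f g) (case F of (f, g) \<Rightarrow> tensor_mod_ar C B \<Delta> f g)"
    if "F \<in> hom (prod_cat ?M ?N) X Y" "G \<in> hom (prod_cat ?M ?N) Y Z" for F G X Y Z
    using that unfolding hom_prod
    by (cases F; cases G) (auto simp: prod_cat_def Mod_simps tensor_mod_ar_def in_hom_iff interchange)
qed

lemma tensor_mod_strict:
  assumes "X \<in> Ob (Mod C B m u)" "Y \<in> Ob (Mod C B m u)" "Z \<in> Ob (Mod C B n u)"
  shows "tensor_mod C B \<Delta> (tensor_mod C B \<Delta> X Y) Z = tensor_mod C B \<Delta> X (tensor_mod C B \<Delta> Y Z)"
  using assms tensor_mod_assoc[of "fst X" "fst Y" "fst Z" "snd X" "snd Y" "snd Z"]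
  by (simp add: Mod_simps module_simps)

lemma tensor_mod_unit_strict:
  assumes "X \<in> Ob (Mod C B k u)"
  shows "tensor_mod C B \<Delta> (triv_mod C \<epsilon>) X = X" "tensor_mod C B \<Delta> X (triv_mod C \<epsilon>) = X"
  using assms tensor_mod_unit[of "fst X" "snd X"] by (simp_all add: Mod_simps module_simps)

lemma tensor_mod_ar_strict:
  assumes "F \<in> Ar (Mod C B m u)" "G \<in> Ar (Mod C B m u)" "H \<in> Ar (Mod C B n u)"
  shows "tensor_mod_ar C B \<Delta> (tensor_mod_ar C B \<Delta> F G) H
    = tensor_mod_ar C B \<Delta> F (tensor_mod_ar C B \<Delta> G H)"
  using assms
  by (auto simp: Mod_def hom_def tensor_mod_ar_def tensor_mod_strict Mod_simps)

lemma tensor_mod_ar_unit_strict: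
  assumes "F \<in> Ar (Mod C B k u)"
  shows "tensor_mod_ar C B \<Delta> (Ide (Mod C B m u) (triv_mod C \<epsilon>)) F = F"
    and "tensor_mod_ar C B \<Delta> F (Ide (Mod C B m u) (triv_mod C \<epsilon>)) = F"
proof -
  have "fst (triv_mod C \<epsilon>) = \<one>"
    by (simp add: triv_mod_def)
  then show "tensor_mod_ar C B \<Delta> (Ide (Mod C B m u) (triv_mod C \<epsilon>)) F = F"
    and "tensor_mod_ar C B \<Delta> F (Ide (Mod C B m u) (triv_mod C \<epsilon>)) = F"
    using assms
    by (auto simp: Mod_def hom_def tensor_mod_ar_def tensor_mod_unit_strict[where k = k])
qed

lemma mod_constraints_strict:
  shows "\<lbrakk>X \<in> Ob (Mod C B m u); Y \<in> Ob (Mod C B m u); Z \<in> Ob (Mod C B n u)\<rbrakk>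
      \<Longrightarrow> mod_assoc C B \<Delta> X Y Z
        = Ide (Mod C B n u) (tensor_mod C B \<Delta> X (tensor_mod C B \<Delta> Y Z))"
    and "X \<in> Ob (Mod C B k u) \<Longrightarrow> mod_lunit C B \<Delta> \<epsilon> X = Ide (Mod C B k u) X"
    and "X \<in> Ob (Mod C B k u) \<Longrightarrow> mod_runit C B \<Delta> \<epsilon> X = Ide (Mod C B k u) X"
  using tensor_mod_strict[of X Y Z] tensor_mod_unit_strict[of X k]
  by (simp_all add: mod_assoc_def mod_lunit_def mod_runit_def Mod_simps fst_tensor_mod
      module_simps assoc_strict lunit_strict runit_strict)

end

context bialgebra
begin

lemma twisted_bialgebra_self: "twisted_bialgebra C B m u \<Delta> \<epsilon> m"
  by unfold_locales (fact comult_mult)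

lemma triv_mod_Ob: "triv_mod C \<epsilon> \<in> Ob (Mod C B m u)"
proof -
  interpret self: twisted_bialgebra C B m u \<Delta> \<epsilon> m
    by (fact twisted_bialgebra_self)
  have "left_module C B m u \<one> \<epsilon>"
  proof
    show "\<epsilon> \<cdot> (m \<otimes> \<iota> \<one>) = \<epsilon> \<cdot> (\<iota> B \<otimes> \<epsilon>)"
      using interchange[of "\<iota> B" \<epsilon> \<epsilon> "\<iota> \<one>"] by (simp add: counit_mult)
  qed (simp_all add: in_hom_iff counit_unit)
  then show ?thesis
    by (simp add: Mod_simps triv_mod_def)
qed

lemma strict_monoidal_Mod: "strict_monoidal_category (Mod_monoidal C B m u \<Delta> \<epsilon>)"
proof (rule strict_monoidal_categoryI)
  interpret self: twisted_bialgebra C B m u \<Delta> \<epsilon> m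
    by (fact twisted_bialgebra_self)
  let ?M = "Mod_monoidal C B m u \<Delta> \<epsilon>"
  show "category ?M"
    by (simp add: category_Mod_monoidal_iff Mod_category)
  show "cat_functor (prod_cat ?M ?M) ?M
      (\<lambda>(X, Y). TensOb ?M X Y) (\<lambda>(f, g). TensAr ?M f g)"
    using self.tensor_mod_bifunctor
    by (simp add: cat_functor_def cat_functor_axioms_def category_Mod_monoidal_iff
        prod_cat_Mod_monoidal)
qed (simp_all add: triv_mod_Ob
    twisted_bialgebra.tensor_mod_strict[OF twisted_bialgebra_self]
    twisted_bialgebra.tensor_mod_unit_strict[OF twisted_bialgebra_self]
    twisted_bialgebra.tensor_mod_ar_strict[OF twisted_bialgebra_self]
    twisted_bialgebra.tensor_mod_ar_unit_strict[OF twisted_bialgebra_self]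
    twisted_bialgebra.mod_constraints_strict[OF twisted_bialgebra_self])

end

theorem (in twisted_bialgebra) left_module_category_Mod:
  "left_module_category (Mod_monoidal C B m u \<Delta> \<epsilon>) (Mod C B n u)
     (tensor_mod C B \<Delta>) (tensor_mod_ar C B \<Delta>) (mod_assoc C B \<Delta>) (mod_lunit C B \<Delta> \<epsilon>)"
proof (rule strict_left_module_categoryI)
  show "cat_functor (prod_cat (Mod_monoidal C B m u \<Delta> \<epsilon>) (Mod C B n u)) (Mod C B n u)
      (\<lambda>(X, P). tensor_mod C B \<Delta> X P) (\<lambda>(f, p). tensor_mod_ar C B \<Delta> f p)"
    using tensor_mod_bifunctor by (simp add: prod_cat_Mod_monoidal)
qed (simp_all add: strict_monoidal_Mod twist.Mod_category tensor_mod_strict tensor_mod_ar_strict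
    tensor_mod_unit_strict tensor_mod_ar_unit_strict mod_constraints_strict)

theorem corollary3p8p3:
  fixes C :: "('o, 'a) braided_cat"
    and B :: 'o
    and m u \<Delta> \<epsilon> \<sigma> :: 'a
  assumes "strict_braided_monoidal_category C"
    and "bialgebra C B m u \<Delta> \<epsilon>"
    and "right_two_cocycle C B m u \<Delta> \<epsilon> \<sigma>"
  shows "left_module_category
           (Mod_monoidal C B m u \<Delta> \<epsilon>)
           (Mod C B (twisted_mult C B m \<Delta> \<sigma>) u)
           (tensor_mod C B \<Delta>)
           (tensor_mod_ar C B \<Delta>)
           (mod_assoc C B \<Delta>)
           (mod_lunit C B \<Delta> \<epsilon>)"
  by (rule twisted_bialgebra.left_module_category_Mod[OF right_two_cocycle.twisted_bialgebra[OF assms(3)]])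

end
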